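(* Let $\Gamma=(V,E)$ be a finite simple graph. A partial map $f:V\to V$ is continuous if and only if its induced cell map $\hat f:P(\Gamma)^\top\to P(\Gamma)^\top$ is order-preserving and satisfies the Principal Fiber Condition.
   Context: The face poset $P(\Gamma)$ is the set of all cells of $\Gamma$ (singletons $\{v\}$, $v\in V$, and edges $\{u,v\}\in E$) ordered by inclusion. A partial map $f:V\to V$ (acting on the right) is continuous if for every cell $C$ the full preimage $\{v\in\operatorname{Dom}(f)\mid vf\in C\}$ is a cell or empty. The extended poset is $P(\Gamma)^\top=P(\Gamma)\cup\{\top\}$ with $X\le\top$ for all $X$. The induced cell map $\hat f:P(\Gamma)^\top\to P(\Gamma)^\top$ is defined by: $\top\hat f=\top$; for a cell $C$, if $C\not\subseteq\operatorname{Dom}(f)$ then $C\hat f=\top$; if $C\subseteq\operatorname{Dom}(f)$ and the image set $Cf$ is a cell then $C\hat f=Cf$; if $C\subseteq\operatorname{Dom}(f)$ and $Cf$ is not a cell then $C\hat f=\top$. For a poset element $C$, $\downarrow C=\{X\mid X\le C\}$. $\hat f$ is order-preserving if $X\le Y$ implies $X\hat f\le Y\hat f$. Principal Fiber Condition: for every $C\in P(\Gamma)^\top$, the preimage $\{X\in P(\Gamma)^\top\mid X\hat f\le C\}$ is either empty or equal to $\downarrow D$ (the principal down-set in $P(\Gamma)^\top$) for some $D\in P(\Gamma)^\top$. *)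

theory Defs
  imports Main "HOL-Library.Lattice_Constructions"
begin

definition finite_simple_graph :: "'a set \<Rightarrow> 'a set set \<Rightarrow> bool" where
  "finite_simple_graph V E \<longleftrightarrow> finite V \<and> (\<forall>e\<in>E. e \<subseteq> V \<and> card e = 2)"

definition cells :: "'a set \<Rightarrow> 'a set set \<Rightarrow> 'a set set" where
  "cells V E = {{v} | v. v \<in> V} \<union> E"

definition partial_map_on :: "'a set \<Rightarrow> ('a \<rightharpoonup> 'a) \<Rightarrow> bool" where
  "partial_map_on V f \<longleftrightarrow> dom f \<subseteq> V \<and> ran f \<subseteq> V"

definition continuous_partial_map :: "'a set \<Rightarrow> 'a set set \<Rightarrow> ('a \<rightharpoonup> 'a) \<Rightarrow> bool" where
  "continuous_partial_map V E f \<longleftrightarrow>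
     (\<forall>C\<in>cells V E. {v \<in> dom f. the (f v) \<in> C} \<in> cells V E \<or> {v \<in> dom f. the (f v) \<in> C} = {})"

text \<open>The order on \<^typ>\<open>'a set top\<close> is the library's: \<^term>\<open>top.Value\<close> is an order embedding of
  the sets ordered by inclusion, and \<^term>\<open>top.Top\<close> is an added greatest element.\<close>

definition extended_face_poset :: "'a set \<Rightarrow> 'a set set \<Rightarrow> 'a set top set" where
  "extended_face_poset V E = insert top.Top (top.Value ` cells V E)"

text \<open>Only the values on the extended face poset are meaningful; for \<open>C \<subseteq> dom f\<close> the set
  \<open>(the \<circ> f) ` C\<close> is the image of \<open>C\<close>.\<close>

fun induced_cell_map :: "'a set \<Rightarrow> 'a set set \<Rightarrow> ('a \<rightharpoonup> 'a) \<Rightarrow> 'a set top \<Rightarrow> 'a set top" where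
  "induced_cell_map V E f top.Top = top.Top"
| "induced_cell_map V E f (top.Value C) =
     (if C \<subseteq> dom f \<and> (the \<circ> f) ` C \<in> cells V E then top.Value ((the \<circ> f) ` C) else top.Top)"

lemma induced_cell_map_in_extended_face_poset:
  "induced_cell_map V E f X \<in> extended_face_poset V E"
  by (cases X) (auto simp: extended_face_poset_def)

definition down_set :: "'b::order set \<Rightarrow> 'b \<Rightarrow> 'b set" where
  "down_set P D = {X \<in> P. X \<le> D}"

definition principal_fiber_condition :: "'b::order set \<Rightarrow> ('b \<Rightarrow> 'b) \<Rightarrow> bool" where
  "principal_fiber_condition P F \<longleftrightarrow>
     (\<forall>C\<in>P. {X \<in> P. F X \<le> C} = {} \<or> (\<exists>D\<in>P. {X \<in> P. F X \<le> C} = down_set P D))"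

end

theory Submission
  imports Defs
begin

text \<open>
  Everything rests on one property of graphs: the cells are closed under passing to nonempty
  subsets. So if a cell \<open>X\<close> of \<open>dom f\<close> is mapped into a cell \<open>C\<close>, its image is automatically a
  cell, and for a cell \<open>C\<close> the fiber of the induced map below \<open>C\<close> consists exactly of the cells
  contained in the full preimage of \<open>C\<close> (\<open>induced_cell_map_fiber\<close>).

  The set of all cells inside a vertex set \<open>A\<close> is empty exactly when \<open>A\<close> is, and it is principal
  exactly when \<open>A\<close> is a cell, because the singletons force a generator to exhaust \<open>A\<close>
  (\<open>cells_within_principal_iff\<close>). With \<open>A\<close> the preimage of \<open>C\<close>, continuity and
  the Principal Fiber Condition thus agree cell by cell. The fiber below \<open>\<top>\<close> is the whole poset,
  which \<open>\<top>\<close> generates. That the induced map preserves the order follows again from closure under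
  subsets (\<open>induced_cell_map_mono_on\<close>).
\<close>

definition preimage_of :: "('a \<rightharpoonup> 'a) \<Rightarrow> 'a set \<Rightarrow> 'a set" where
  "preimage_of f C = {v \<in> dom f. the (f v) \<in> C}"

lemma cell_nonempty:
  assumes "finite_simple_graph V E" and "C \<in> cells V E"
  shows "C \<noteq> {}"
  using assms unfolding finite_simple_graph_def cells_def by fastforce

lemma nonempty_subset_of_cell:
  assumes "finite_simple_graph V E" and "C \<in> cells V E" and "B \<subseteq> C" and "B \<noteq> {}"
  shows "B \<in> cells V E"
proof (cases "C \<in> E")
  case True
  with assms(1) have "C \<subseteq> V" and "card C = 2"
    by (simp_all add: finite_simple_graph_def)
  then obtain u v where "C = {u, v}" "u \<in> V" "v \<in> V"
    by (auto simp: card_2_iff)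
  with assms(3,4) have "B = C \<or> B = {u} \<or> B = {v}" by blast
  with \<open>C \<in> cells V E\<close> \<open>u \<in> V\<close> \<open>v \<in> V\<close> show ?thesis
    unfolding cells_def by blast
next
  case False
  with assms show ?thesis unfolding cells_def by auto
qed

text \<open>
  Only a pair whose larger member avoids \<open>\<top>\<close> matters: this member then has a cell as image, and
  the image of the smaller one is a nonempty subset of it.
\<close>

lemma induced_cell_map_mono_on:
  assumes "finite_simple_graph V E"
  shows "mono_on (extended_face_poset V E) (induced_cell_map V E f)"
proof (rule mono_onI)
  fix X Y
  assume X: "X \<in> extended_face_poset V E" and "Y \<in> extended_face_poset V E" and "X \<le> Y"
  show "induced_cell_map V E f X \<le> induced_cell_map V E f Y"
  proof (cases "induced_cell_map V E f Y")
    case Top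
    then show ?thesis by simp
  next
    case (Value D)
    then obtain B where B: "Y = top.Value B" "B \<subseteq> dom f" "(the \<circ> f) ` B \<in> cells V E"
      by (cases Y) (auto split: if_splits)
    with X \<open>X \<le> Y\<close> obtain A where A: "X = top.Value A" "A \<in> cells V E" "A \<subseteq> B"
      by (auto simp: extended_face_poset_def)
    have "(the \<circ> f) ` A \<in> cells V E"
      using assms B(3) by (rule nonempty_subset_of_cell)
        (use A cell_nonempty[OF assms] in auto)
    with A B show ?thesis by auto
  qed
qed

text \<open>
  The image of a cell inside \<open>preimage_of f C\<close> is a nonempty subset of \<open>C\<close>, hence itself a cell, so
  the induced map sends it to that image and not to \<open>\<top>\<close>. Conversely, \<open>\<top>\<close> is never below \<open>C\<close>.
\<close>

lemma induced_cell_map_fiber: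
  assumes "finite_simple_graph V E" and "C \<in> cells V E"
  shows "{X \<in> extended_face_poset V E. induced_cell_map V E f X \<le> top.Value C}
    = top.Value ` {B \<in> cells V E. B \<subseteq> preimage_of f C}"
proof -
  have "induced_cell_map V E f (top.Value B) \<le> top.Value C \<longleftrightarrow> B \<subseteq> preimage_of f C"
    if "B \<in> cells V E" for B
  proof
    assume "induced_cell_map V E f (top.Value B) \<le> top.Value C"
    then show "B \<subseteq> preimage_of f C"
      by (auto simp: preimage_of_def split: if_splits)
  next
    assume B: "B \<subseteq> preimage_of f C"
    then have "(the \<circ> f) ` B \<in> cells V E"
      by (intro nonempty_subset_of_cell[OF assms])
        (use cell_nonempty[OF assms(1) that] in \<open>auto simp: preimage_of_def\<close>)
    with B show "induced_cell_map V E f (top.Value B) \<le> top.Value C"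
      by (auto simp: preimage_of_def)
  qed
  then show ?thesis
    by (auto simp: extended_face_poset_def)
qed

lemma cells_within_empty_iff:
  assumes "finite_simple_graph V E" and "A \<subseteq> V"
  shows "{B \<in> cells V E. B \<subseteq> A} = {} \<longleftrightarrow> A = {}"
  using cell_nonempty[OF assms(1)] assms(2) unfolding cells_def by blast

text \<open>
  A generator cannot be \<open>\<top>\<close>, since \<open>\<top>\<close> would then lie below it. If it is a cell \<open>D\<close>, then
  \<open>D \<subseteq> A\<close> because \<open>D\<close> lies in its own down-set, and \<open>A \<subseteq> D\<close> because every singleton in \<open>A\<close> is a
  cell.
\<close>

lemma cells_within_principal_iff:
  assumes "A \<subseteq> V"
  shows "(\<exists>D \<in> extended_face_poset V E.
      top.Value ` {B \<in> cells V E. B \<subseteq> A} = down_set (extended_face_poset V E) D)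
    \<longleftrightarrow> A \<in> cells V E"
proof
  assume "\<exists>D \<in> extended_face_poset V E.
      top.Value ` {B \<in> cells V E. B \<subseteq> A} = down_set (extended_face_poset V E) D"
  then obtain D where D: "D \<in> extended_face_poset V E"
    and eq: "top.Value ` {B \<in> cells V E. B \<subseteq> A} = down_set (extended_face_poset V E) D"
    by blast
  have "D \<in> top.Value ` {B \<in> cells V E. B \<subseteq> A}"
    unfolding eq using D by (simp add: down_set_def)
  then obtain B where B: "D = top.Value B" "B \<in> cells V E" "B \<subseteq> A" by blast
  have "A \<subseteq> B"
  proof
    fix v assume "v \<in> A"
    with assms have "top.Value {v} \<in> top.Value ` {B \<in> cells V E. B \<subseteq> A}"
      by (auto simp: cells_def)
    then show "v \<in> B"
      unfolding eq B(1) by (simp add: down_set_def)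
  qed
  with B show "A \<in> cells V E" by auto
next
  assume "A \<in> cells V E"
  then show "\<exists>D \<in> extended_face_poset V E.
      top.Value ` {B \<in> cells V E. B \<subseteq> A} = down_set (extended_face_poset V E) D"
    by (intro bexI[of _ "top.Value A"]) (auto simp: down_set_def extended_face_poset_def)
qed

theorem theorem20p4:
  fixes V :: "'a set" and E :: "'a set set" and f :: "'a \<rightharpoonup> 'a"
  assumes "finite_simple_graph V E"
    and "partial_map_on V f"
  shows "continuous_partial_map V E f \<longleftrightarrow>
    mono_on (extended_face_poset V E) (induced_cell_map V E f) \<and>
    principal_fiber_condition (extended_face_poset V E) (induced_cell_map V E f)"
proof -
  let ?P = "extended_face_poset V E"
  let ?fiber = "\<lambda>C. {X \<in> ?P. induced_cell_map V E f X \<le> C}"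
  let ?principal = "\<lambda>C. ?fiber C = {} \<or> (\<exists>D\<in>?P. ?fiber C = down_set ?P D)"
  have cellwise: "?principal (top.Value C) \<longleftrightarrow> preimage_of f C \<in> cells V E \<or> preimage_of f C = {}"
    if "C \<in> cells V E" for C
  proof -
    have "preimage_of f C \<subseteq> V"
      using assms(2) by (auto simp: preimage_of_def partial_map_on_def)
    then show ?thesis
      unfolding induced_cell_map_fiber[OF assms(1) that] image_is_empty
      by (simp only: cells_within_empty_iff[OF assms(1)] cells_within_principal_iff disj_commute)
  qed
  have "?fiber top.Top = down_set ?P top.Top"
    by (simp add: down_set_def)
  then have at_Top: "?principal top.Top"
    by (intro disjI2 bexI[of _ top.Top]) (auto simp: extended_face_poset_def)
  have "principal_fiber_condition ?P (induced_cell_map V E f)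
    \<longleftrightarrow> (\<forall>C\<in>?P. ?principal C)"
    by (simp add: principal_fiber_condition_def)
  also have "\<dots> \<longleftrightarrow> (\<forall>C\<in>cells V E. ?principal (top.Value C))"
  proof -
    have "(\<forall>C\<in>?P. Q C) \<longleftrightarrow> Q top.Top \<and> (\<forall>C\<in>cells V E. Q (top.Value C))" for Q
      by (simp add: extended_face_poset_def)
    from this[of ?principal] show ?thesis
      using at_Top by (simp only: simp_thms)
  qed
  also have "\<dots> \<longleftrightarrow> continuous_partial_map V E f"
    unfolding continuous_partial_map_def preimage_of_def[symmetric]
    using cellwise by (intro ball_cong refl)
  finally show ?thesis
    using induced_cell_map_mono_on[OF assms(1)] by blast
qed

end
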